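(* Let $f\in\mathcal C\setminus\{0\}$ and let $G(\mathcal A(f))$ be the directed graph with vertex set $\mathcal A(f)$ in which a pair $(S,T)$ with $S\neq T$ is an edge if and only if $T=S\setminus\{\operatorname{m}(S)\}$. Then $G(\mathcal A(f))$ is a tree with root $\Delta(f)=\{0\}\cup\{x\in\mathcal C\mid x\succ f\}$.
   Context: Notation: $\mathbb N=\{0,1,2,\dots\}$, $p\ge 1$, and $\Lambda=\{e_1,\dots,e_p\}$ is the canonical basis of $\mathbb N^p$. $\mathcal C\subseteq\mathbb N^p$ is a fixed non-negative integer cone (the set of points of $\mathbb N^p$ lying in a finitely generated rational convex cone), with at least $p$ extremal rays. A $\mathcal C$-semigroup is a finitely generated submonoid $S\subseteq\mathcal C$ of $\mathbb N^p$ such that the minimal integer cone containing $S$ is $\mathcal C$ and $\mathcal H(S)=\mathcal C\setminus S$ is finite. A monomial order $\preceq$ on $\mathbb N^p$ is fixed: a total order compatible with addition with $0\preceq x$ for all $x$; it is assumed that $\{x\in\mathcal C\mid x\preceq k\}$ is finite for every $k\in\mathcal C$. $\operatorname{Fb}(S)=\max_\preceq\mathcal H(S)$ (and $-\sum_i e_i$ if $\mathcal H(S)=\emptyset$), $\operatorname{N}(S)=\{x\in S\mid x\prec\operatorname{Fb}(S)\}$, $\operatorname{m}(S)=\min_\preceq(S\setminus\{0\})$. A $\mathcal C$-semigroup $S$ is an $\mathcal A$-semigroup if for every $s\in S$ and $e\in\Lambda$ the set $\{s,s+e\}$ is not contained in $\operatorname{N}(S)$. $\mathcal A(f)$ is the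 set of all $\mathcal A$-semigroups $S$ with $\operatorname{Fb}(S)=f$. A directed graph is a tree with root $R$ if every vertex $S$ is connected to $R$ by a unique sequence of edges $(S_0,S_1),(S_1,S_2),\dots,(S_{n-1},S_n)$ with $S_0=S$ and $S_n=R$ (the empty sequence when $S=R$). *)

theory Defs
  imports "HOL-Analysis.Analysis" "Graph_Theory.Pair_Digraph"
begin

definition real_vec :: "nat ^ 'p \<Rightarrow> real ^ 'p" where
  "real_vec x = (\<chi> i. real (x $ i))"

definition int_vec :: "nat ^ 'p \<Rightarrow> int ^ 'p" where
  "int_vec x = (\<chi> i. int (x $ i))"

(* The generators are arbitrary rational vectors; only the cone's points in the
   orthant matter. The hull of the empty set is {0}. *)
definition integer_cone :: "(nat ^ 'p) set \<Rightarrow> bool" where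
  "integer_cone C \<longleftrightarrow>
     (\<exists>V :: (real ^ 'p) set. finite V \<and> (\<forall>v\<in>V. \<forall>i. v $ i \<in> \<rat>) \<and>
        C = {x. real_vec x \<in> convex_cone hull V})"

(* Rays are taken in the real cone spanned by C. That cone is finitely generated, so the set
   of its extremal rays is finite and its card is the true number of rays. *)
definition extremal_rays :: "(nat ^ 'p) set \<Rightarrow> (real ^ 'p) set set" where
  "extremal_rays C =
     {R. (\<exists>v. v \<noteq> 0 \<and> R = {c *\<^sub>R v | c. c \<ge> 0}) \<and> R face_of (convex_cone hull (real_vec ` C))}"

(* Integer cones are closed under binary intersection, so a minimal one containing S is least. *)
definition minimal_integer_cone :: "(nat ^ 'p) set \<Rightarrow> (nat ^ 'p) set \<Rightarrow> bool" where
  "minimal_integer_cone S C \<longleftrightarrow>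
     integer_cone C \<and> S \<subseteq> C \<and> (\<forall>D. integer_cone D \<and> S \<subseteq> D \<longrightarrow> C \<subseteq> D)"

definition monomial_order :: "(nat ^ 'p \<Rightarrow> nat ^ 'p \<Rightarrow> bool) \<Rightarrow> bool" where
  "monomial_order le \<longleftrightarrow>
     reflp le \<and> antisymp le \<and> transp le \<and> totalp le \<and>
     (\<forall>x y z. le x y \<longrightarrow> le (x + z) (y + z)) \<and> (\<forall>x. le 0 x)"

definition strict :: "('a \<Rightarrow> 'a \<Rightarrow> bool) \<Rightarrow> 'a \<Rightarrow> 'a \<Rightarrow> bool" where
  "strict le x y \<longleftrightarrow> le x y \<and> x \<noteq> y"

definition min_wrt :: "('a \<Rightarrow> 'a \<Rightarrow> bool) \<Rightarrow> 'a set \<Rightarrow> 'a" where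
  "min_wrt le A = (THE x. x \<in> A \<and> (\<forall>y\<in>A. le x y))"

definition max_wrt :: "('a \<Rightarrow> 'a \<Rightarrow> bool) \<Rightarrow> 'a set \<Rightarrow> 'a" where
  "max_wrt le A = (THE x. x \<in> A \<and> (\<forall>y\<in>A. le y x))"

(* The unique translation-invariant extension of le to integer vectors; it makes the comparison
   of elements of S with the conventional Frobenius vector (-1,...,-1) meaningful. *)
definition int_order :: "(nat ^ 'p \<Rightarrow> nat ^ 'p \<Rightarrow> bool) \<Rightarrow> int ^ 'p \<Rightarrow> int ^ 'p \<Rightarrow> bool" where
  "int_order le u v \<longleftrightarrow> (\<exists>x y. le x y \<and> v - u = int_vec y - int_vec x)"

lemma int_vec_add: "int_vec (x + y) = int_vec x + int_vec y"
  by (simp add: int_vec_def vec_eq_iff)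

lemma int_vec_eq_iff [simp]: "int_vec x = int_vec y \<longleftrightarrow> x = y"
  by (simp add: int_vec_def vec_eq_iff)

lemma int_order_int_vec:
  assumes "monomial_order le"
  shows "int_order le (int_vec x) (int_vec y) \<longleftrightarrow> le x y"
proof
  assume "int_order le (int_vec x) (int_vec y)"
  then obtain a b where ab: "le a b" "int_vec y - int_vec x = int_vec b - int_vec a"
    by (auto simp: int_order_def)
  then have "int_vec (y + a) = int_vec (b + x)"
    unfolding int_vec_add by (metis add.commute diff_add_eq diff_eq_eq)
  then have eq: "y + a = b + x"
    by simp
  have "le (x + a) (y + a)"
    using assms ab(1) unfolding eq monomial_order_def by (metis add.commute)
  show "le x y"
  proof (rule ccontr)
    assume "\<not> le x y"
    then have "le y x" "x \<noteq> y"
      using assms unfolding monomial_order_def by (metis reflpD totalpD)+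
    then have "le (y + a) (x + a)"
      using assms unfolding monomial_order_def by blast
    with \<open>le (x + a) (y + a)\<close> have "x + a = y + a"
      using assms unfolding monomial_order_def by (metis antisympD)
    with \<open>x \<noteq> y\<close> show False
      by (simp add: vec_eq_iff)
  qed
qed (auto simp: int_order_def)

definition submonoid :: "'a::monoid_add set \<Rightarrow> bool" where
  "submonoid S \<longleftrightarrow> 0 \<in> S \<and> (\<forall>x\<in>S. \<forall>y\<in>S. x + y \<in> S)"

definition gaps :: "(nat ^ 'p) set \<Rightarrow> (nat ^ 'p) set \<Rightarrow> (nat ^ 'p) set" where
  "gaps C S = C - S"

definition C_semigroup :: "(nat ^ 'p) set \<Rightarrow> (nat ^ 'p) set \<Rightarrow> bool" where
  "C_semigroup C S \<longleftrightarrow>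
     submonoid S \<and> (\<exists>A. finite A \<and> S = submonoid hull A) \<and>
     S \<subseteq> C \<and> minimal_integer_cone S C \<and> finite (gaps C S)"

definition Fb :: "(nat ^ 'p \<Rightarrow> nat ^ 'p \<Rightarrow> bool) \<Rightarrow> (nat ^ 'p) set \<Rightarrow> (nat ^ 'p) set \<Rightarrow> int ^ 'p" where
  "Fb le C S =
     (if gaps C S = {} then - (\<Sum>i\<in>UNIV. axis i 1) else int_vec (max_wrt le (gaps C S)))"

definition Nset :: "(nat ^ 'p \<Rightarrow> nat ^ 'p \<Rightarrow> bool) \<Rightarrow> (nat ^ 'p) set \<Rightarrow> (nat ^ 'p) set \<Rightarrow> (nat ^ 'p) set" where
  "Nset le C S = {x \<in> S. strict (int_order le) (int_vec x) (Fb le C S)}"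

definition m_elt :: "(nat ^ 'p \<Rightarrow> nat ^ 'p \<Rightarrow> bool) \<Rightarrow> (nat ^ 'p) set \<Rightarrow> nat ^ 'p" where
  "m_elt le S = min_wrt le (S - {0})"

definition A_semigroup ::
    "(nat ^ 'p \<Rightarrow> nat ^ 'p \<Rightarrow> bool) \<Rightarrow> (nat ^ 'p) set \<Rightarrow> (nat ^ 'p) set \<Rightarrow> bool" where
  "A_semigroup le C S \<longleftrightarrow>
     C_semigroup C S \<and> (\<forall>s\<in>S. \<forall>i. \<not> {s, s + axis i 1} \<subseteq> Nset le C S)"

definition A_semigroups ::
    "(nat ^ 'p \<Rightarrow> nat ^ 'p \<Rightarrow> bool) \<Rightarrow> (nat ^ 'p) set \<Rightarrow> nat ^ 'p \<Rightarrow> (nat ^ 'p) set set" where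
  "A_semigroups le C f = {S. A_semigroup le C S \<and> Fb le C S = int_vec f}"

definition \<Delta> ::
    "(nat ^ 'p \<Rightarrow> nat ^ 'p \<Rightarrow> bool) \<Rightarrow> (nat ^ 'p) set \<Rightarrow> nat ^ 'p \<Rightarrow> (nat ^ 'p) set" where
  "\<Delta> le C f = {0} \<union> {x \<in> C. strict le f x}"

definition tree_with_root :: "'v pair_pre_digraph \<Rightarrow> 'v \<Rightarrow> bool" where
  "tree_with_root G R \<longleftrightarrow>
     pair_wf_digraph G \<and> R \<in> pverts G \<and>
     (\<forall>S\<in>pverts G. \<exists>!es. pre_digraph.awalk (with_proj G) S es R)"

definition A_graph ::
    "(nat ^ 'p \<Rightarrow> nat ^ 'p \<Rightarrow> bool) \<Rightarrow> (nat ^ 'p) set \<Rightarrow> nat ^ 'p \<Rightarrow> (nat ^ 'p) set pair_pre_digraph" where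
  "A_graph le C f =
     \<lparr>pverts = A_semigroups le C f,
      parcs = {(S, T). S \<in> A_semigroups le C f \<and> T \<in> A_semigroups le C f \<and>
                       S \<noteq> T \<and> T = S - {m_elt le S}}\<rparr>"

end

theory Submission
  imports Defs
begin

text \<open>
  Removing the least nonzero element \<open>m\<close> of a monoid leaves a monoid, because a sum of two nonzero
  elements strictly exceeds both summands and so never equals \<open>m\<close>. If \<open>m\<close> lies below the Frobenius
  element \<open>f\<close>, then the new gap \<open>m\<close> does not change the greatest gap, and the forbidden pairs
  \<open>{s, s + e}\<close> below \<open>f\<close> can only disappear. Every member of \<open>\<A>(f)\<close> contains \<open>\<Delta>(f)\<close>, and a member
  other than \<open>\<Delta>(f)\<close> has a nonzero element below \<open>f\<close>; thus it has exactly one outgoing edge, to a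
  member with one element fewer outside \<open>\<Delta>(f)\<close>, whereas \<open>\<Delta>(f)\<close> has none
  (\<open>A_semigroups_remove_min\<close>, \<open>Delta_subset\<close>). Following these forced edges is the only way to reach
  \<open>\<Delta>(f)\<close>, and it terminates since the number of elements outside \<open>\<Delta>(f)\<close> drops at each step
  (\<open>tree_with_root_descending\<close>).

  What remains is that the sets so obtained are \<open>\<C>\<close>-semigroups, that is, that they are finitely
  generated and span no smaller integer cone. Both hold for every submonoid of \<open>\<C>\<close> with finite
  complement (\<open>C_semigroup_iff\<close>). The cone is spanned because some multiple of each
  point of \<open>\<C>\<close> avoids the finitely many gaps. Finite generation is a form of Gordan's lemma: up to
  a bounded lattice vector, a point of \<open>\<C>\<close> is a combination of the rational generators with natural
  coefficients, so Dickson's lemma gives finitely many nonzero \<open>b \<in> S\<close> such that every nonzero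
  element of \<open>S\<close> lies in some \<open>b + \<C>\<close>. The differences that fall into a gap add only
  finitely many further generators.
\<close>

section \<open>Finite generation of cofinite submonoids of an integer cone\<close>

text \<open>
  Dickson's lemma, for points measured by finitely many natural-valued functions. In the induction,
  the points for which the new function is large are dominated through the old functions alone; for
  each of the finitely many small values one restricts to the corresponding level set.
\<close>

lemma dickson:
  fixes F :: "('a \<Rightarrow> nat) set"
  assumes "finite F"
  shows "\<exists>B\<subseteq>A. finite B \<and> (\<forall>a\<in>A. \<exists>b\<in>B. \<forall>g\<in>F. g b \<le> g a)"
  using assms
proof (induction F arbitrary: A rule: finite_induct)
  case empty
  show ?case
  proof (cases "A = {}")
    case False
    then obtain a where "a \<in> A" by blast
    then show ?thesis by (intro exI[of _ "{a}"]) auto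
  qed auto
next
  case (insert h F)
  obtain B where B: "B \<subseteq> A" "finite B" "\<forall>a\<in>A. \<exists>b\<in>B. \<forall>g\<in>F. g b \<le> g a"
    using insert.IH by blast
  have "\<exists>D\<subseteq>{a\<in>A. h a = k}. finite D \<and> (\<forall>a\<in>{a\<in>A. h a = k}. \<exists>b\<in>D. \<forall>g\<in>F. g b \<le> g a)" for k
    by (rule insert.IH)
  then obtain D where D: "\<And>k. D k \<subseteq> {a\<in>A. h a = k}" "\<And>k. finite (D k)"
    "\<And>k. \<forall>a\<in>{a\<in>A. h a = k}. \<exists>b\<in>D k. \<forall>g\<in>F. g b \<le> g a"
    by metis
  define K where "K = sum h B"
  have K: "h b \<le> K" if "b \<in> B" for b
    unfolding K_def using that B(2) by (simp add: member_le_sum)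
  have "\<exists>b\<in>B \<union> (\<Union>k<K. D k). \<forall>g\<in>insert h F. g b \<le> g a" if a: "a \<in> A" for a
  proof (cases "K \<le> h a")
    case True
    with B(3) K a show ?thesis by (metis UnI1 insertE le_trans)
  next
    case False
    obtain b where b: "b \<in> D (h a)" "\<forall>g\<in>F. g b \<le> g a"
      using D(3) a by blast
    with D(1) have "h b = h a" by blast
    with b False show ?thesis by (intro bexI[of _ b]) auto
  qed
  moreover have "B \<union> (\<Union>k<K. D k) \<subseteq> A" using B(1) D(1) by blast
  moreover have "finite (B \<union> (\<Union>k<K. D k))" using B(2) D(2) by auto
  ultimately show ?case by (intro exI[of _ "B \<union> (\<Union>k<K. D k)"]) auto
qed

lemma sum_in_convex_cone_hull:
  assumes "\<And>v. v \<in> A \<Longrightarrow> g v \<in> convex_cone hull V"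
  shows "sum g A \<in> convex_cone hull V"
  using assms
  by (induction A rule: infinite_finite_induct)
    (auto simp: convex_cone_hull_contains_0 intro: convex_cone_hull_add)

lemma convex_cone_hull_finite_subset:
  fixes V :: "'a::real_vector set"
  assumes "finite V"
  shows "convex_cone hull V \<subseteq> {\<Sum>v\<in>V. l v *\<^sub>R v | l. \<forall>v\<in>V. 0 \<le> l v}"
proof (rule hull_minimal)
  let ?K = "{\<Sum>v\<in>V. l v *\<^sub>R v | l. \<forall>v\<in>V. 0 \<le> l v}"
  show "V \<subseteq> ?K"
  proof
    fix v assume v: "v \<in> V"
    then have "v = (\<Sum>u\<in>V. (if u = v then 1 else 0) *\<^sub>R u)"
      using assms by (simp add: if_distrib[of "\<lambda>c. c *\<^sub>R _"] cong: if_cong)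
    then show "v \<in> ?K" by force
  qed
  have add: "x + y \<in> ?K" if xy: "x \<in> ?K" "y \<in> ?K" for x y
  proof -
    obtain l l' where "\<forall>v\<in>V. 0 \<le> l v" "\<forall>v\<in>V. 0 \<le> l' v"
      "x = (\<Sum>v\<in>V. l v *\<^sub>R v)" "y = (\<Sum>v\<in>V. l' v *\<^sub>R v)"
      using xy by blast
    then show ?thesis
      by (auto simp: sum.distrib scaleR_left_distrib intro!: exI[of _ "\<lambda>v. l v + l' v"])
  qed
  have scale: "c *\<^sub>R x \<in> ?K" if c: "0 \<le> c" and x: "x \<in> ?K" for c x
  proof -
    obtain l where "\<forall>v\<in>V. 0 \<le> l v" "x = (\<Sum>v\<in>V. l v *\<^sub>R v)"
      using x by blast
    then show ?thesis using c
      by (auto simp: scaleR_sum_right intro!: exI[of _ "\<lambda>v. c * l v"])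
  qed
  have zero: "0 \<in> ?K" by (auto intro!: exI[of _ "\<lambda>_. 0"])
  show "convex_cone ?K"
    unfolding convex_cone_iff using add scale zero by (intro conjI ballI allI impI)
qed

lemma real_vec_add: "real_vec (x + y) = real_vec x + real_vec y"
  by (simp add: real_vec_def vec_eq_iff)

lemma integer_cone_submonoid:
  fixes C :: "(nat ^ 'p) set"
  assumes "integer_cone C"
  shows "submonoid C"
proof -
  obtain V where "C = {x. real_vec x \<in> convex_cone hull V}"
    using assms unfolding integer_cone_def by blast
  moreover have "real_vec (0 :: nat ^ 'p) = 0" by (simp add: real_vec_def vec_eq_iff)
  ultimately show ?thesis
    by (simp add: submonoid_def real_vec_add convex_cone_hull_contains_0 convex_cone_hull_add)
qed

lemma rational_vector_denominator:
  fixes v :: "real ^ 'p"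
  assumes "\<forall>i. v $ i \<in> \<rat>"
  shows "\<exists>d::nat. 0 < d \<and> (\<forall>i. real d * v $ i \<in> \<int>)"
proof -
  have "\<exists>n a. 0 < n \<and> v $ i = real_of_int a / real n" for i
    using assms unfolding Rats_eq_int_div_nat by blast
  then obtain n a where n: "\<And>i. 0 < n i" "\<And>i. v $ i = real_of_int (a i) / real (n i)"
    by metis
  have "real (\<Prod>i\<in>UNIV. n i) * v $ j \<in> \<int>" for j
  proof -
    have "(\<Prod>i\<in>UNIV. n i) = n j * (\<Prod>i\<in>UNIV - {j}. n i)"
      by (simp add: prod.remove)
    with n(1)[of j] n(2)[of j]
    have "real (\<Prod>i\<in>UNIV. n i) * v $ j = real (\<Prod>i\<in>UNIV - {j}. n i) * real_of_int (a j)"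
      by simp
    moreover have "\<dots> \<in> \<int>" by (intro Ints_mult) auto
    ultimately show ?thesis by (simp only:)
  qed
  moreover have "0 < (\<Prod>i\<in>UNIV. n i)" using n(1) by (simp add: prod_pos)
  ultimately show ?thesis by blast
qed

text \<open>
  With integral multiples \<open>w v\<close> of the generators, a point \<open>x\<close> of the cone is
  \<open>\<Sum>n\<^sub>v w v + r\<close>, where the \<open>n\<^sub>v\<close> are the integer parts of its coefficients and \<open>r\<close> is a lattice
  vector with entries bounded by some \<open>N\<close>. If \<open>b\<close> and \<open>x\<close> have the same \<open>r\<close> and all coordinates and
  all \<open>n\<^sub>v\<close> of \<open>b\<close> are at most those of \<open>x\<close>, then \<open>x - b\<close> is again a point of the cone. Equality of
  the remainders is two inequalities, one between the naturals \<open>N + r\<^sub>i\<close> and one between the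
  naturals \<open>N - r\<^sub>i\<close>.
\<close>

lemma integer_cone_difference_order:
  fixes C :: "(nat ^ 'p) set"
  assumes "integer_cone C"
  shows "\<exists>F :: (nat ^ 'p \<Rightarrow> nat) set. finite F \<and>
    (\<forall>b\<in>C. \<forall>x\<in>C. (\<forall>g\<in>F. g b \<le> g x) \<longrightarrow> (\<exists>c\<in>C. x = b + c))"
proof -
  obtain V :: "(real ^ 'p) set" where V: "finite V" "\<forall>v\<in>V. \<forall>i. v $ i \<in> \<rat>"
    and C: "C = {x. real_vec x \<in> convex_cone hull V}"
    using assms unfolding integer_cone_def by blast
  obtain d :: "real ^ 'p \<Rightarrow> nat" where
    d: "\<And>v. v \<in> V \<Longrightarrow> 0 < d v" "\<And>v i. v \<in> V \<Longrightarrow> real (d v) * v $ i \<in> \<int>"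
    using rational_vector_denominator V(2) by metis
  define w where "w v = real (d v) *\<^sub>R v" for v :: "real ^ 'p"
  have "\<exists>l. (\<forall>v\<in>V. 0 \<le> l v) \<and> real_vec x = (\<Sum>v\<in>V. l v *\<^sub>R v)" if "x \<in> C" for x
    using that convex_cone_hull_finite_subset[OF V(1)] unfolding C by blast
  then obtain l where l: "\<And>x v. x \<in> C \<Longrightarrow> v \<in> V \<Longrightarrow> 0 \<le> l x v"
    "\<And>x. x \<in> C \<Longrightarrow> real_vec x = (\<Sum>v\<in>V. l x v *\<^sub>R v)"
    by metis
  define n where "n x v = nat \<lfloor>l x v / d v\<rfloor>" for x v
  define r where "r x = (\<Sum>v\<in>V. frac (l x v / d v) *\<^sub>R w v)" for x
  define N where "N = nat \<lceil>\<Sum>v\<in>V. \<Sum>i\<in>UNIV. \<bar>w v $ i\<bar>\<rceil>"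
  have decomp: "real_vec x = (\<Sum>v\<in>V. real (n x v) *\<^sub>R w v) + r x" if x: "x \<in> C" for x
  proof -
    have "l x v *\<^sub>R v = real (n x v) *\<^sub>R w v + frac (l x v / d v) *\<^sub>R w v" if v: "v \<in> V" for v
    proof -
      have "real (n x v) + frac (l x v / d v) = l x v / d v"
        using l(1)[OF x v] by (simp add: n_def frac_def)
      then have "(real (n x v) + frac (l x v / d v)) * real (d v) = l x v"
        using d(1)[OF v] by simp
      then show ?thesis
        unfolding w_def by (simp flip: scaleR_left_distrib distrib_right)
    qed
    then show ?thesis
      using l(2)[OF x] by (simp add: r_def sum.distrib)
  qed
  have r_int: "r x $ i \<in> \<int>" if x: "x \<in> C" for x i
  proof -
    have "r x $ i = real (x $ i) - (\<Sum>v\<in>V. real (n x v) * (real (d v) * v $ i))"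
      using arg_cong[OF decomp[OF x], of "\<lambda>u. u $ i"]
      by (simp add: real_vec_def w_def mult.assoc)
    moreover have "\<dots> \<in> \<int>"
      by (intro Ints_diff Ints_sum Ints_mult d(2)) auto
    ultimately show ?thesis by simp
  qed
  have r_bound: "\<bar>r x $ i\<bar> \<le> real N" for x i
  proof -
    have "\<bar>r x $ i\<bar> \<le> (\<Sum>v\<in>V. \<bar>frac (l x v / d v) * w v $ i\<bar>)"
      unfolding r_def by (simp add: sum_abs)
    also have "\<dots> \<le> (\<Sum>v\<in>V. \<Sum>i\<in>UNIV. \<bar>w v $ i\<bar>)"
    proof (rule sum_mono)
      fix v
      have "\<bar>frac (l x v / d v) * w v $ i\<bar> \<le> 1 * \<bar>w v $ i\<bar>"
        unfolding abs_mult by (intro mult_right_mono) (auto simp: frac_lt_1 less_imp_le)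
      also have "1 * \<bar>w v $ i\<bar> \<le> (\<Sum>i\<in>UNIV. \<bar>w v $ i\<bar>)"
        by (simp add: member_le_sum[of i UNIV "\<lambda>i. \<bar>w v $ i\<bar>"])
      finally show "\<bar>frac (l x v / d v) * w v $ i\<bar> \<le> (\<Sum>i\<in>UNIV. \<bar>w v $ i\<bar>)" .
    qed
    also have "\<dots> \<le> real N" unfolding N_def by linarith
    finally show ?thesis .
  qed
  define F where "F = range (\<lambda>i x. x $ i) \<union> (\<lambda>v x. n x v) ` V \<union>
    range (\<lambda>i x. nat \<lfloor>real N + r x $ i\<rfloor>) \<union> range (\<lambda>i x. nat \<lfloor>real N - r x $ i\<rfloor>)"
  have "finite F" unfolding F_def using V(1) by simp
  moreover have "\<exists>c\<in>C. x = b + c"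
    if b: "b \<in> C" and x: "x \<in> C" and le: "\<forall>g\<in>F. g b \<le> g x" for b x
  proof -
    have coord: "b $ i \<le> x $ i" for i using le unfolding F_def by auto
    have n: "n b v \<le> n x v" if "v \<in> V" for v
      using le that unfolding F_def by auto
    have "r b $ i = r x $ i" for i
    proof -
      obtain p q where pq: "r b $ i = real_of_int p" "r x $ i = real_of_int q"
        using r_int[OF b] r_int[OF x] by (meson Ints_cases)
      have "nat \<lfloor>real N + r b $ i\<rfloor> \<le> nat \<lfloor>real N + r x $ i\<rfloor>"
        "nat \<lfloor>real N - r b $ i\<rfloor> \<le> nat \<lfloor>real N - r x $ i\<rfloor>"
        using le unfolding F_def by auto
      moreover have "\<lfloor>real N + real_of_int k\<rfloor> = int N + k"
        "\<lfloor>real N - real_of_int k\<rfloor> = int N - k" for k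
        by linarith+
      moreover have "\<bar>p\<bar> \<le> int N" "\<bar>q\<bar> \<le> int N"
        using r_bound[of b i] r_bound[of x i] unfolding pq by linarith+
      ultimately show ?thesis unfolding pq by simp
    qed
    then have r: "r b = r x" by (simp add: vec_eq_iff)
    define c where "c = x - b"
    have xc: "x = b + c" using coord by (simp add: c_def vec_eq_iff)
    have "real_vec c = real_vec x - real_vec b" unfolding xc real_vec_add by simp
    also have "\<dots> = (\<Sum>v\<in>V. real (n x v) *\<^sub>R w v) - (\<Sum>v\<in>V. real (n b v) *\<^sub>R w v)"
      using decomp[OF x] decomp[OF b] r by simp
    also have "\<dots> = (\<Sum>v\<in>V. real (n x v - n b v) *\<^sub>R w v)"
      using n by (simp add: sum_subtractf[symmetric] scaleR_left_diff_distrib[symmetric]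
          of_nat_diff cong: sum.cong)
    also have "\<dots> \<in> convex_cone hull V"
      unfolding w_def by (intro sum_in_convex_cone_hull convex_cone_hull_mul) (auto intro: hull_inc)
    finally show ?thesis using xc unfolding C by blast
  qed
  ultimately show ?thesis by blast
qed

lemma submonoid_hull: "submonoid (submonoid hull A)"
  by (rule hull_in) (auto simp: submonoid_def)

text \<open>
  A nonzero \<open>x \<in> S\<close> is \<open>b + c\<close> with \<open>b\<close> from a finite set of nonzero elements and \<open>c\<close> in the cone.
  Either \<open>c\<close> is a smaller element of \<open>S\<close>, or \<open>c\<close> is one of the finitely many gaps and \<open>x\<close> itself is
  listed among the generators.
\<close>

lemma cofinite_submonoid_finitely_generated:
  fixes C S :: "(nat ^ 'p) set"
  assumes C: "integer_cone C" and S: "submonoid S" "S \<subseteq> C" and fin: "finite (gaps C S)"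
  shows "\<exists>A. finite A \<and> S = submonoid hull A"
proof -
  obtain F :: "(nat ^ 'p \<Rightarrow> nat) set" where F: "finite F"
    "\<forall>b\<in>C. \<forall>x\<in>C. (\<forall>g\<in>F. g b \<le> g x) \<longrightarrow> (\<exists>c\<in>C. x = b + c)"
    using integer_cone_difference_order[OF C] by (elim exE conjE)
  obtain B where B: "B \<subseteq> S - {0}" "finite B"
    "\<forall>a\<in>S - {0}. \<exists>b\<in>B. \<forall>g\<in>F. g b \<le> g a"
    using dickson[OF F(1), of "S - {0}"] by (elim exE conjE)
  define A where "A = B \<union> (\<lambda>(b, h). b + h) ` (B \<times> gaps C S) \<inter> S"
  have "x \<in> submonoid hull A" if "x \<in> S" for x
    using that
  proof (induction "\<Sum>i\<in>UNIV. x $ i" arbitrary: x rule: less_induct)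
    case less
    show ?case
    proof (cases "x = 0")
      case True
      then show ?thesis using submonoid_hull[of A] by (simp add: submonoid_def)
    next
      case False
      with less.prems obtain b where b: "b \<in> B" "\<forall>g\<in>F. g b \<le> g x" using B(3) by blast
      then obtain c where c: "c \<in> C" "x = b + c"
        using F(2) B(1) S(2) less.prems by (metis DiffD1 subsetD)
      show ?thesis
      proof (cases "c \<in> S")
        case True
        have "b \<noteq> 0" using b(1) B(1) by blast
        then obtain i where "b $ i \<noteq> 0" by (auto simp: vec_eq_iff)
        then have "(\<Sum>i\<in>UNIV. b $ i) > 0" by (simp add: sum_pos2)
        then have "(\<Sum>i\<in>UNIV. c $ i) < (\<Sum>i\<in>UNIV. x $ i)"
          unfolding c(2) by (simp add: sum.distrib)
        then have "c \<in> submonoid hull A" using less.hyps True by blast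
        moreover have "b \<in> submonoid hull A" using b(1) unfolding A_def by (auto intro: hull_inc)
        ultimately show ?thesis
          using submonoid_hull[of A] unfolding c(2) submonoid_def by blast
      next
        case False
        then have "x \<in> A" using b(1) c less.prems unfolding A_def gaps_def by auto
        then show ?thesis by (rule hull_inc)
      qed
    qed
  qed
  moreover have "submonoid hull A \<subseteq> S"
    using B(1) S(1) unfolding A_def by (intro hull_minimal) auto
  moreover have "finite A" unfolding A_def using B(2) fin by auto
  ultimately show ?thesis by blast
qed

text \<open>
  The multiples \<open>n x\<close> of a nonzero \<open>x \<in> C\<close> are pairwise distinct, so one with \<open>n > 0\<close> lies in \<open>S\<close>;
  dividing by \<open>n\<close> shows that \<open>x\<close> lies in every integer cone that contains \<open>S\<close>.
\<close>

lemma cofinite_submonoid_minimal_integer_cone: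
  fixes C S :: "(nat ^ 'p) set"
  assumes C: "integer_cone C" and S: "submonoid S" "S \<subseteq> C" and fin: "finite (gaps C S)"
  shows "minimal_integer_cone S C"
proof -
  have "x \<in> D" if D: "integer_cone D" "S \<subseteq> D" and x: "x \<in> C" for D x
  proof (cases "x = 0")
    case True
    then show ?thesis using D S(1) by (auto simp: submonoid_def)
  next
    case False
    then obtain i where i: "x $ i \<noteq> 0" by (auto simp: vec_eq_iff)
    define k where "k n = (\<chi> i. n * x $ i)" for n :: nat
    have k_C: "k n \<in> C" for n
    proof (induction n)
      case 0
      show ?case using S by (auto simp: k_def submonoid_def zero_vec_def)
    next
      case (Suc n)
      have "k (Suc n) = x + k n" by (simp add: k_def vec_eq_iff)
      with Suc x integer_cone_submonoid[OF C] show ?case by (simp add: submonoid_def)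
    qed
    have "inj k" using i by (auto simp: inj_def k_def vec_eq_iff dest!: spec[of _ i])
    then have "infinite (k ` {0<..})"
      by (metis finite_imageD infinite_Ioi inj_on_subset subset_UNIV)
    then have "\<not> k ` {0<..} \<subseteq> gaps C S" using fin by (metis finite_subset)
    then obtain n where n: "0 < n" "k n \<in> S" using k_C by (auto simp: gaps_def)
    obtain V where V: "D = {x. real_vec x \<in> convex_cone hull V}"
      using D(1) unfolding integer_cone_def by blast
    have "real_vec x = (1 / real n) *\<^sub>R real_vec (k n)"
      using n(1) by (simp add: real_vec_def k_def vec_eq_iff)
    moreover have "real_vec (k n) \<in> convex_cone hull V" using n(2) D(2) V by blast
    ultimately show ?thesis unfolding V by (simp add: convex_cone_hull_mul)
  qed
  with C S(2) show ?thesis unfolding minimal_integer_cone_def by blast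
qed

lemma C_semigroup_iff:
  assumes "integer_cone C"
  shows "C_semigroup C S \<longleftrightarrow> submonoid S \<and> S \<subseteq> C \<and> finite (gaps C S)"
  unfolding C_semigroup_def
  using cofinite_submonoid_finitely_generated[OF assms]
    cofinite_submonoid_minimal_integer_cone[OF assms] by blast

section \<open>The monomial order and Frobenius elements\<close>

lemma finite_has_least:
  assumes "finite A" "A \<noteq> {}" "transp le" "totalp le" "reflp le"
  shows "\<exists>x\<in>A. \<forall>y\<in>A. le x y"
  using assms(1,2)
proof (induction A rule: finite_ne_induct)
  case (singleton x)
  show ?case using assms(5) by (simp add: reflpD)
next
  case (insert x A)
  then obtain z where z: "z \<in> A" "\<forall>y\<in>A. le z y" by blast
  show ?case
  proof (cases "le x z")
    case True
    then have "\<forall>y\<in>insert x A. le x y"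
      using z(2) assms(3,5) by (auto intro: reflpD transpD[of le x z])
    then show ?thesis by blast
  next
    case False
    with z(1) insert.hyps(3) assms(4) have "le z x" by (metis totalpD)
    with z show ?thesis by blast
  qed
qed

locale ordered_integer_cone =
  fixes C :: "(nat ^ 'p) set" and le :: "nat ^ 'p \<Rightarrow> nat ^ 'p \<Rightarrow> bool"
  assumes cone: "integer_cone C"
    and monomial: "monomial_order le"
    and finite_below: "\<forall>k\<in>C. finite {x \<in> C. le x k}"
begin

lemma le_refl: "le x x"
  using monomial unfolding monomial_order_def by (meson reflpD)

lemma le_trans: "le x y \<Longrightarrow> le y z \<Longrightarrow> le x z"
  using monomial unfolding monomial_order_def by (meson transpD)

lemma le_antisym: "le x y \<Longrightarrow> le y x \<Longrightarrow> x = y"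
  using monomial unfolding monomial_order_def by (meson antisympD)

lemma le_total: "le x y \<or> le y x"
  using monomial unfolding monomial_order_def by (metis reflpD totalpD)

lemma strict_iff: "strict le x y \<longleftrightarrow> \<not> le y x"
  unfolding strict_def using le_total[of x y] le_antisym[of x y] le_refl by blast

lemma le_add: "le x (x + y)"
  using monomial unfolding monomial_order_def by (metis add_0 add.commute)

lemma max_wrt_eqI:
  assumes "f \<in> A" "\<forall>y\<in>A. le y f"
  shows "max_wrt le A = f"
  unfolding max_wrt_def
proof (rule the_equality)
  show "x = f" if "x \<in> A \<and> (\<forall>y\<in>A. le y x)" for x
    using that assms le_antisym[of x f] by blast
qed (use assms in blast)

lemma min_wrt_least:
  assumes "finite {x \<in> A. le x k}" "k \<in> A"
  shows "min_wrt le A \<in> A \<and> (\<forall>y\<in>A. le (min_wrt le A) y)"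
proof -
  have "\<exists>x\<in>{x \<in> A. le x k}. \<forall>y\<in>{x \<in> A. le x k}. le x y"
    using assms le_refl monomial unfolding monomial_order_def
    by (intro finite_has_least) auto
  then obtain x where x: "x \<in> A" "le x k" "\<forall>y\<in>{x \<in> A. le x k}. le x y" by blast
  have least: "le x y" if "y \<in> A" for y
    using x(2,3) that le_total[of y k] le_trans[of x k y] by blast
  show ?thesis
    unfolding min_wrt_def
  proof (rule theI)
    show "z = x" if "z \<in> A \<and> (\<forall>y\<in>A. le z y)" for z
      using that x(1) least le_antisym[of z x] by blast
  qed (use x(1) least in blast)
qed

text \<open>
  The conventional value \<open>(-1,\<dots>,-1)\<close> is not a vector of naturals, so it never interferes here.
\<close>

lemma Fb_eq_int_vec_iff:
  assumes "finite (gaps C S)"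
  shows "Fb le C S = int_vec f \<longleftrightarrow> f \<in> gaps C S \<and> (\<forall>x\<in>gaps C S. le x f)"
proof (cases "gaps C S = {}")
  case True
  have "- (\<Sum>i\<in>UNIV. axis i 1) \<noteq> int_vec f"
  proof
    assume "- (\<Sum>i\<in>UNIV. axis i 1) = int_vec f"
    then have "(- (\<Sum>i\<in>UNIV. axis i 1)) $ j = int (f $ j)" for j
      by (simp add: int_vec_def)
    moreover have "(- (\<Sum>i\<in>UNIV. axis i 1) :: int ^ 'p) $ j = -1" for j
      by (simp add: axis_def)
    ultimately show False by (metis neg_0_le_iff_le not_one_le_zero of_nat_0_le_iff)
  qed
  with True show ?thesis by (simp add: Fb_def)
next
  case False
  let ?ge = "\<lambda>x y. le y x"
  have "\<exists>g\<in>gaps C S. \<forall>x\<in>gaps C S. ?ge g x"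
  proof (rule finite_has_least)
    show "transp ?ge" using le_trans by (auto intro: transpI)
    show "totalp ?ge" using le_total by (auto intro: totalpI)
    show "reflp ?ge" using le_refl by (auto intro: reflpI)
  qed (use assms False in auto)
  then obtain g where g: "g \<in> gaps C S" "\<forall>x\<in>gaps C S. le x g" by blast
  with False have "Fb le C S = int_vec g" by (simp add: Fb_def max_wrt_eqI)
  moreover have "g = f" if "f \<in> gaps C S" "\<forall>x\<in>gaps C S. le x f"
    using that g le_antisym[of g f] by blast
  ultimately show ?thesis using g by auto
qed

section \<open>Members of the family with a given Frobenius element\<close>

lemma A_semigroups_iff:
  "S \<in> A_semigroups le C f \<longleftrightarrow>
    submonoid S \<and> S \<subseteq> C \<and> finite (gaps C S) \<and> f \<in> gaps C S \<and> (\<forall>x\<in>gaps C S. le x f) \<and>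
    (\<forall>s\<in>S. \<forall>i. s + axis i 1 \<in> S \<longrightarrow> strict le s f \<longrightarrow> \<not> strict le (s + axis i 1) f)"
proof -
  have "Nset le C S = {x \<in> S. strict le x f}" if "Fb le C S = int_vec f"
    unfolding Nset_def that strict_def by (simp add: int_order_int_vec[OF monomial])
  then show ?thesis
    unfolding A_semigroups_def A_semigroup_def C_semigroup_iff[OF cone]
    by (auto simp: Fb_eq_int_vec_iff)
qed

lemma Delta_iff: "x \<in> \<Delta> le C f \<longleftrightarrow> x = 0 \<or> x \<in> C \<and> \<not> le x f"
  by (auto simp: \<Delta>_def strict_iff)

lemma Delta_in_A_semigroups:
  assumes f: "f \<in> C - {0}"
  shows "\<Delta> le C f \<in> A_semigroups le C f"
  unfolding A_semigroups_iff
proof (intro conjI ballI allI impI)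
  have C: "submonoid C" by (rule integer_cone_submonoid[OF cone])
  have "\<not> le (x + y) f" if "\<not> le x f" for x y
    using that le_trans[OF le_add] by blast
  with C show "submonoid (\<Delta> le C f)"
    by (auto simp: submonoid_def Delta_iff)
  show "\<Delta> le C f \<subseteq> C" using C by (auto simp: submonoid_def Delta_iff)
  show below: "le x f" if "x \<in> gaps C (\<Delta> le C f)" for x
    using that by (auto simp: gaps_def Delta_iff)
  have "gaps C (\<Delta> le C f) \<subseteq> {x \<in> C. le x f}"
    using below by (auto simp: gaps_def)
  then show "finite (gaps C (\<Delta> le C f))"
    using finite_below f by (meson DiffD1 finite_subset)
  show "f \<in> gaps C (\<Delta> le C f)"
    using f le_refl by (auto simp: gaps_def Delta_iff)
  fix s i
  assume "s + axis i 1 \<in> \<Delta> le C f"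
  moreover have "s + axis i 1 \<noteq> 0" by (auto simp: vec_eq_iff intro!: exI[of _ i])
  ultimately have "\<not> le (s + axis i 1) f" by (simp add: Delta_iff)
  then show "\<not> strict le (s + axis i 1) f" by (simp add: strict_def)
qed

lemma Delta_subset:
  assumes "S \<in> A_semigroups le C f"
  shows "\<Delta> le C f \<subseteq> S"
  using assms unfolding A_semigroups_iff
  by (auto simp: Delta_iff submonoid_def gaps_def)

lemma finite_diff_Delta:
  assumes "S \<in> A_semigroups le C f"
  shows "finite (S - \<Delta> le C f)"
proof (rule finite_subset)
  show "S - \<Delta> le C f \<subseteq> {x \<in> C. le x f}"
    using assms unfolding A_semigroups_iff by (auto simp: Delta_iff)
  show "finite {x \<in> C. le x f}"
    using assms finite_below unfolding A_semigroups_iff by (auto simp: gaps_def)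
qed

text \<open>
  If \<open>S\<close> differs from \<open>\<Delta>(f)\<close>, its least nonzero element \<open>m\<close> lies strictly below \<open>f\<close>, so \<open>f\<close> stays
  the greatest gap once \<open>m\<close> is removed. Since \<open>m\<close> is irreducible in \<open>S\<close>, the rest is a monoid.
\<close>

lemma A_semigroups_remove_min:
  assumes S: "S \<in> A_semigroups le C f" and ne: "S \<noteq> \<Delta> le C f"
  shows "m_elt le S \<in> S - \<Delta> le C f" "S - {m_elt le S} \<in> A_semigroups le C f"
proof -
  note S' = S[unfolded A_semigroups_iff]
  obtain k where k: "k \<in> S" "k \<notin> \<Delta> le C f" using Delta_subset[OF S] ne by blast
  with S' have kC: "k \<in> C" "k \<in> S - {0}" by (auto simp: Delta_iff)
  have "le k f" using k kC(1) by (auto simp: Delta_iff)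
  have "finite {x \<in> S - {0}. le x k}"
    using finite_below kC(1) S' by (auto intro: finite_subset[of _ "{x \<in> C. le x k}"])
  from min_wrt_least[OF this kC(2)]
  have m: "m_elt le S \<in> S - {0}" "\<And>y. y \<in> S - {0} \<Longrightarrow> le (m_elt le S) y"
    unfolding m_elt_def by blast+
  have mf: "le (m_elt le S) f"
    using m(2)[OF kC(2)] \<open>le k f\<close> by (rule le_trans)
  then show "m_elt le S \<in> S - \<Delta> le C f"
    using m(1) by (simp add: Delta_iff)
  have irreducible: "x + y \<noteq> m_elt le S" if xy: "x \<in> S - {m_elt le S}" "y \<in> S - {m_elt le S}" for x y
  proof
    assume eq: "x + y = m_elt le S"
    with xy have "x \<in> S - {0}" by auto
    then have "le (m_elt le S) x" by (rule m(2))
    moreover have "le x (m_elt le S)" unfolding eq[symmetric] by (rule le_add)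
    ultimately show False using xy(1) le_antisym[of "m_elt le S" x] by blast
  qed
  have gaps: "gaps C (S - {m_elt le S}) = insert (m_elt le S) (gaps C S)"
    using m(1) S' by (auto simp: gaps_def)
  show "S - {m_elt le S} \<in> A_semigroups le C f"
    unfolding A_semigroups_iff gaps
  proof (intro conjI)
    show "submonoid (S - {m_elt le S})"
      using irreducible m(1) S' by (auto simp: submonoid_def)
  qed (use S' mf m(1) in \<open>auto simp: gaps_def\<close>)
qed

end

section \<open>The tree\<close>

text \<open>
  A graph in which every vertex other than \<open>R\<close> has exactly one outgoing edge, \<open>R\<close> has none, and a
  natural-valued measure drops along the forced edges, is a tree with root \<open>R\<close>.
\<close>

lemma tree_with_root_descending:
  assumes wf: "pair_wf_digraph G" and R: "R \<in> pverts G"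
    and sink: "\<And>T. (R, T) \<notin> parcs G"
    and next_arc: "\<And>S T. S \<in> pverts G \<Longrightarrow> S \<noteq> R \<Longrightarrow> (S, T) \<in> parcs G \<longleftrightarrow> T = h S"
    and descent: "\<And>S. S \<in> pverts G \<Longrightarrow> S \<noteq> R \<Longrightarrow> \<mu> (h S) < (\<mu> S :: nat)"
  shows "tree_with_root G R"
proof -
  interpret pair_wf_digraph G by (rule wf)
  have step: "awalk S (e # es) R \<longleftrightarrow> e \<in> parcs G \<and> fst e = S \<and> awalk (snd e) es R" for S e es
    unfolding awalk_def using arc_fst_in_verts arc_snd_in_verts by auto
  have "\<exists>!es. awalk S es R" if "S \<in> pverts G" for S
    using that
  proof (induction "\<mu> S" arbitrary: S rule: less_induct)
    case less
    show ?case
    proof (cases "S = R")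
      case True
      have "awalk R es R \<longleftrightarrow> es = []" for es
        using R sink by (cases es) (auto simp: step awalk_def)
      with True show ?thesis by auto
    next
      case False
      then have hS: "h S \<in> pverts G"
        using next_arc less.prems wellformed'(2) by blast
      then obtain es where es: "\<And>es'. awalk (h S) es' R \<longleftrightarrow> es' = es"
        using less.hyps descent less.prems False by (metis (no_types, lifting))
      have "awalk S es' R \<longleftrightarrow> es' = (S, h S) # es" for es'
      proof (cases es')
        case Nil
        with False show ?thesis by (auto simp: awalk_def)
      next
        case (Cons e es'')
        have "e \<in> parcs G \<and> fst e = S \<longleftrightarrow> e = (S, h S)"
          using next_arc[OF less.prems False] by (cases e) auto
        then have "awalk S es' R \<longleftrightarrow> e = (S, h S) \<and> awalk (h S) es'' R"
          unfolding Cons step by auto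
        with es Cons show ?thesis by simp
      qed
      then show ?thesis by auto
    qed
  qed
  with wf R show ?thesis unfolding tree_with_root_def by blast
qed

theorem proposition3:
  fixes C :: "(nat ^ 'p) set" and le :: "nat ^ 'p \<Rightarrow> nat ^ 'p \<Rightarrow> bool" and f :: "nat ^ 'p"
  assumes "integer_cone C"
    and "CARD('p) \<le> card (extremal_rays C)"
    and "monomial_order le"
    and "\<forall>k\<in>C. finite {x \<in> C. le x k}"
    and "f \<in> C - {0}"
  shows "tree_with_root (A_graph le C f) (\<Delta> le C f)"
proof -
  interpret ordered_integer_cone C le by standard fact+
  show ?thesis
  proof (rule tree_with_root_descending)
    show "pair_wf_digraph (A_graph le C f)" by standard (auto simp: A_graph_def)
    show "\<Delta> le C f \<in> pverts (A_graph le C f)"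
      using Delta_in_A_semigroups[OF assms(5)] by (simp add: A_graph_def)
    \<comment> \<open>The target of an edge from \<open>\<Delta>(f)\<close> would be a proper subset of the least member.\<close>
    show "(\<Delta> le C f, T) \<notin> parcs (A_graph le C f)" for T
      using Delta_subset[of T f] by (auto simp: A_graph_def)
    fix S
    assume "S \<in> pverts (A_graph le C f)" and ne: "S \<noteq> \<Delta> le C f"
    then have S: "S \<in> A_semigroups le C f" by (simp add: A_graph_def)
    note m = A_semigroups_remove_min[OF S ne]
    show "(S, T) \<in> parcs (A_graph le C f) \<longleftrightarrow> T = S - {m_elt le S}" for T
      using S m by (auto simp: A_graph_def)
    show "card (S - {m_elt le S} - \<Delta> le C f) < card (S - \<Delta> le C f)"
      using m(1) finite_diff_Delta[OF S] by (intro psubset_card_mono) auto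
  qed
qed

end
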